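(* Let $C_{\mathcal{A}}=(\mathrm{Mat}_N(\mathbb{C}),\langle\partial\rangle_D,\mathbb{C}^N,\varphi)$ be a real calculus over a 1-dimensional real Lie algebra $\langle\partial\rangle$, and let $(C_{\mathcal{A}},h_x)$ be a real metric calculus, where $h_x(u,v)=x\cdot u^\dagger v$ with $x\in\mathbb{R}\setminus\{0\}$. Then there exists a unique connection $\nabla$ such that $(C_{\mathcal{A}},h_x,\nabla)$ is pseudo-Riemannian if and only if $v_0=\varphi(\partial)$ is an eigenvector of $\hat{D}(\partial)$ with eigenvalue $\lambda_\partial$ (i.e. $v_0\hat{D}(\partial)=\lambda_\partial v_0$ for some $\lambda_\partial\in\mathbb{C}$). In this case, the Levi-Civita connection $\nabla$ is given by $$\nabla_\partial v=\lambda_\partial v-v\hat{D}(\partial)$$ for $v\in\mathbb{C}^N$.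
   Context: A hermitian derivation of a unital complex $*$-algebra $\mathcal{A}$ is a derivation $d$ with $d(a^* )=d(a)^*$. $\mathrm{Mat}_N(\mathbb{C})$ has conjugate transpose $\dagger$ as its involution; $\mathbb{C}^N$ consists of row vectors, a right $\mathrm{Mat}_N(\mathbb{C})$-module by right multiplication, so $u^\dagger v\in\mathrm{Mat}_N(\mathbb{C})$. Real calculus $(\mathcal{A},\mathfrak{g}_D,M,\varphi)$: $\mathcal{A}$ a unital $*$-algebra, $\mathfrak{g}$ a real Lie algebra with a faithful representation $D:\mathfrak{g}\to\mathrm{Der}(\mathcal{A})$ by hermitian derivations (write $\partial(a)=D(\partial)(a)$), $M$ a right $\mathcal{A}$-module, $\varphi:\mathfrak{g}\to M$ an $\mathbb{R}$-linear map whose image generates $M$ as an $\mathcal{A}$-module. A metric on $M$ is a map $h:M\times M\to\mathcal{A}$, additive in the second argument, with $h(m_1,m_2a)=h(m_1,m_2)a$, $h(m_1,m_2)=h(m_2,m_1)^*$, and nondegenerate ($h(m_1,m_2)=0$ for all $m_2$ implies $m_1=0$). $(C_{\mathcal{A}},h)$ is a real metric calculus if $h(\varphi(\partial_1),\varphi(\partial_2))$ is self-adjoint for all $\partial_1,\partial_2\in\mathfrak{g}$. An affine connection is a map $\nabla:\mathfrak{g}\times M\to M$, $(\partial,m)\mapsto\nabla_\partial m$, additive in $m$, $\mathbb{R}$-linear in $\partial$, with $\nabla_\partial(ma)=(\nabla_\partial m)a+m\partial(a)$. $(C_{\mathcal{A}},h,\nabla)$ is a real connection calculus if $h(\nabla_\partial\varphi(\partial_1),\varphi(\partial_2))$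 is self-adjoint for all $\partial,\partial_1,\partial_2\in\mathfrak{g}$. It is pseudo-Riemannian (and $\nabla$ is then called a Levi-Civita connection) if moreover it is metric, $\partial(h(m,n))=h(\nabla_\partial m,n)+h(m,\nabla_\partial n)$ for all $\partial\in\mathfrak g$, $m,n\in M$, and torsion-free, $\nabla_{\partial_1}\varphi(\partial_2)-\nabla_{\partial_2}\varphi(\partial_1)-\varphi([\partial_1,\partial_2])=0$ for all $\partial_1,\partial_2\in\mathfrak{g}$. $\hat{D}(\partial)\in\mathrm{Mat}_N(\mathbb{C})$ is the unique trace-free matrix with $D(\partial)=[\hat{D}(\partial),\cdot]$; it is anti-hermitian. Eigenvectors are understood as row (left) eigenvectors. *)

theory Defs
  imports "HOL-Analysis.Analysis"
begin

section \<open>Unital complex *-algebras and right modules\<close>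

text \<open>
  The type \<^typ>\<open>complex^'n^'n\<close> carries the entrywise product as its type-class multiplication,
  so the operations of an algebra are passed explicitly. Only the additive group comes
  from the type class.
\<close>

record 'a alg =
  smul :: "complex \<Rightarrow> 'a \<Rightarrow> 'a"
  mul :: "'a \<Rightarrow> 'a \<Rightarrow> 'a"
  unit :: 'a
  star :: "'a \<Rightarrow> 'a"

locale star_algebra =
  fixes A :: "'a::ab_group_add alg"
  assumes vector_space: "vector_space (smul A)"
    and mul_assoc: "mul A (mul A a b) c = mul A a (mul A b c)"
    and mul_add_left: "mul A (a + b) c = mul A a c + mul A b c"
    and mul_add_right: "mul A a (b + c) = mul A a b + mul A a c"
    and mul_smul_left: "mul A (smul A z a) b = smul A z (mul A a b)"
    and mul_smul_right: "mul A a (smul A z b) = smul A z (mul A a b)"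
    and unit_left: "mul A (unit A) a = a"
    and unit_right: "mul A a (unit A) = a"
    and star_add: "star A (a + b) = star A a + star A b"
    and star_smul: "star A (smul A z a) = smul A (cnj z) (star A a)"
    and star_mul: "star A (mul A a b) = mul A (star A b) (star A a)"
    and star_star: "star A (star A a) = a"

definition self_adjoint :: "'a alg \<Rightarrow> 'a \<Rightarrow> bool" where
  "self_adjoint A a \<longleftrightarrow> star A a = a"

definition derivation :: "'a::ab_group_add alg \<Rightarrow> ('a \<Rightarrow> 'a) \<Rightarrow> bool" where
  "derivation A \<delta> \<longleftrightarrow> Vector_Spaces.linear (smul A) (smul A) \<delta> \<and>
     (\<forall>a b. \<delta> (mul A a b) = mul A (\<delta> a) b + mul A a (\<delta> b))"

definition hermitian_derivation :: "'a::ab_group_add alg \<Rightarrow> ('a \<Rightarrow> 'a) \<Rightarrow> bool" where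
  "hermitian_derivation A \<delta> \<longleftrightarrow> derivation A \<delta> \<and> (\<forall>a. \<delta> (star A a) = star A (\<delta> a))"

locale right_module = star_algebra A
  for A :: "'a::ab_group_add alg" +
  fixes act :: "'m::ab_group_add \<Rightarrow> 'a \<Rightarrow> 'm"
  assumes act_add_left: "act (m + n) a = act m a + act n a"
    and act_add_right: "act m (a + b) = act m a + act m b"
    and act_mul: "act m (mul A a b) = act (act m a) b"
    and act_unit: "act m (unit A) = m"

definition right_submodule :: "('m::ab_group_add \<Rightarrow> 'a \<Rightarrow> 'm) \<Rightarrow> 'm set \<Rightarrow> bool" where
  "right_submodule act S \<longleftrightarrow>
     0 \<in> S \<and> (\<forall>m\<in>S. \<forall>n\<in>S. m + n \<in> S) \<and> (\<forall>m\<in>S. \<forall>a. act m a \<in> S)"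

text \<open>A module over a unital complex algebra is a real vector space through \<open>r \<mapsto> r \<cdot> 1\<close>.\<close>

definition module_scaleR :: "'a alg \<Rightarrow> ('m \<Rightarrow> 'a \<Rightarrow> 'm) \<Rightarrow> real \<Rightarrow> 'm \<Rightarrow> 'm" where
  "module_scaleR A act r m = act m (smul A (complex_of_real r) (unit A))"

section \<open>Real calculi\<close>

locale lie_algebra =
  fixes br :: "'g::real_vector \<Rightarrow> 'g \<Rightarrow> 'g"
  assumes br_bilinear: "bilinear br"
    and br_self: "br x x = 0"
    and jacobi: "br x (br y z) + br y (br z x) + br z (br x y) = 0"

locale real_calculus = lie_algebra br + right_module A act
  for A :: "'a::ab_group_add alg"
    and br :: "'g::real_vector \<Rightarrow> 'g \<Rightarrow> 'g"
    and D :: "'g \<Rightarrow> 'a \<Rightarrow> 'a"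
    and act :: "'m::ab_group_add \<Rightarrow> 'a \<Rightarrow> 'm"
    and \<phi> :: "'g \<Rightarrow> 'm" +
  assumes D_hermitian: "hermitian_derivation A (D x)"
    and D_add: "D (x + y) a = D x a + D y a"
    and D_scaleR: "D (r *\<^sub>R x) a = smul A (complex_of_real r) (D x a)"
    and D_br: "D (br x y) a = D x (D y a) - D y (D x a)"
    and D_faithful: "inj D"
    and \<phi>_add: "\<phi> (x + y) = \<phi> x + \<phi> y"
    and \<phi>_scaleR: "\<phi> (r *\<^sub>R x) = module_scaleR A act r (\<phi> x)"
    and \<phi>_generates: "right_submodule act hull (range \<phi>) = UNIV"

locale metric = right_module A act
  for A :: "'a::ab_group_add alg"
    and act :: "'m::ab_group_add \<Rightarrow> 'a \<Rightarrow> 'm" +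
  fixes h :: "'m \<Rightarrow> 'm \<Rightarrow> 'a"
  assumes h_add: "h m (n + n') = h m n + h m n'"
    and h_act: "h m (act n a) = mul A (h m n) a"
    and h_star: "h m n = star A (h n m)"
    and h_nondegenerate: "(\<And>n. h m n = 0) \<Longrightarrow> m = 0"

locale real_metric_calculus = real_calculus A br D act \<phi> + metric A act h
  for A :: "'a::ab_group_add alg"
    and br :: "'g::real_vector \<Rightarrow> 'g \<Rightarrow> 'g"
    and D :: "'g \<Rightarrow> 'a \<Rightarrow> 'a"
    and act :: "'m::ab_group_add \<Rightarrow> 'a \<Rightarrow> 'm"
    and \<phi> :: "'g \<Rightarrow> 'm"
    and h :: "'m \<Rightarrow> 'm \<Rightarrow> 'a" +
  assumes h_\<phi>_self_adjoint: "self_adjoint A (h (\<phi> x) (\<phi> y))"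

locale affine_connection = real_calculus A br D act \<phi>
  for A :: "'a::ab_group_add alg"
    and br :: "'g::real_vector \<Rightarrow> 'g \<Rightarrow> 'g"
    and D :: "'g \<Rightarrow> 'a \<Rightarrow> 'a"
    and act :: "'m::ab_group_add \<Rightarrow> 'a \<Rightarrow> 'm"
    and \<phi> :: "'g \<Rightarrow> 'm" +
  fixes nabla :: "'g \<Rightarrow> 'm \<Rightarrow> 'm"
  assumes nabla_add_right: "nabla x (m + n) = nabla x m + nabla x n"
    and nabla_add_left: "nabla (x + y) m = nabla x m + nabla y m"
    and nabla_scaleR: "nabla (r *\<^sub>R x) m = module_scaleR A act r (nabla x m)"
    and nabla_Leibniz: "nabla x (act m a) = act (nabla x m) a + act m (D x a)"

locale real_connection_calculus =
  real_metric_calculus A br D act \<phi> h + affine_connection A br D act \<phi> nabla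
  for A :: "'a::ab_group_add alg"
    and br :: "'g::real_vector \<Rightarrow> 'g \<Rightarrow> 'g"
    and D :: "'g \<Rightarrow> 'a \<Rightarrow> 'a"
    and act :: "'m::ab_group_add \<Rightarrow> 'a \<Rightarrow> 'm"
    and \<phi> :: "'g \<Rightarrow> 'm"
    and h :: "'m \<Rightarrow> 'm \<Rightarrow> 'a"
    and nabla :: "'g \<Rightarrow> 'm \<Rightarrow> 'm" +
  assumes h_nabla_self_adjoint: "self_adjoint A (h (nabla x (\<phi> y)) (\<phi> z))"

locale pseudo_Riemannian_calculus = real_connection_calculus A br D act \<phi> h nabla
  for A :: "'a::ab_group_add alg"
    and br :: "'g::real_vector \<Rightarrow> 'g \<Rightarrow> 'g"
    and D :: "'g \<Rightarrow> 'a \<Rightarrow> 'a"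
    and act :: "'m::ab_group_add \<Rightarrow> 'a \<Rightarrow> 'm"
    and \<phi> :: "'g \<Rightarrow> 'm"
    and h :: "'m \<Rightarrow> 'm \<Rightarrow> 'a"
    and nabla :: "'g \<Rightarrow> 'm \<Rightarrow> 'm" +
  assumes nabla_metric: "D x (h m n) = h (nabla x m) n + h m (nabla x n)"
    and torsion_free: "nabla x (\<phi> y) - nabla y (\<phi> x) - \<phi> (br x y) = 0"

section \<open>The matrix algebra acting on row vectors\<close>

definition dagger :: "complex^'n^'m \<Rightarrow> complex^'m^'n" where
  "dagger X = map_matrix cnj (transpose X)"

definition Mat_alg :: "(complex^'n^'n) alg" where
  "Mat_alg = \<lparr>smul = (\<lambda>z. map_matrix ((*) z)), mul = (**), unit = mat 1, star = dagger\<rparr>"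

lemma star_algebra_Mat: "star_algebra (Mat_alg :: (complex^'n^'n) alg)"
  unfolding star_algebra_def vector_space_def
  by (auto simp: Mat_alg_def dagger_def map_matrix_def vec_eq_iff transpose_def
      matrix_mul_assoc algebra_simps)
    (simp_all add: matrix_matrix_mult_def sum_distrib_left sum.distrib algebra_simps)

lemma right_module_Mat: "right_module Mat_alg ((v*) :: complex^'n \<Rightarrow> _)"
  unfolding right_module_def right_module_axioms_def
  using star_algebra_Mat
  by (auto simp: Mat_alg_def vector_matrix_mul_assoc vector_matrix_mult_add_rdistrib
      vector_matrix_left_distrib)

text \<open>In \<open>h_x(u, v) = x \<cdot> u\<^sup>\<dagger> v\<close> the row vectors are \<open>1 \<times> N\<close> matrices.\<close>

definition h_metric :: "real \<Rightarrow> complex^'n \<Rightarrow> complex^'n \<Rightarrow> complex^'n^'n" where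
  "h_metric x u v = x *\<^sub>R (dagger (rowvector u :: complex^'n^1) ** (rowvector v :: complex^'n^1))"

lemma h_metric_nth: "h_metric x u v $ i $ j = complex_of_real x * cnj (u $ i) * v $ j"
  by (simp add: h_metric_def dagger_def rowvector_def map_matrix_def transpose_def
      matrix_matrix_mult_def scaleR_conv_of_real [symmetric])

definition D_hat :: "('g \<Rightarrow> complex^'n^'n \<Rightarrow> complex^'n^'n) \<Rightarrow> 'g \<Rightarrow> complex^'n^'n" where
  "D_hat D x = (THE H. trace H = 0 \<and> (\<forall>a. D x a = H ** a - a ** H))"

definition left_eigenvector :: "complex^'n^'n \<Rightarrow> complex^'n \<Rightarrow> complex \<Rightarrow> bool" where
  "left_eigenvector H v c \<longleftrightarrow> v \<noteq> 0 \<and> v v* H = c *s v"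

end

theory Submission
  imports Defs
begin

text \<open>
  Write \<open>H\<close> for \<^term>\<open>D_hat D d\<close> and \<open>v\<^sub>0\<close> for \<^term>\<open>\<phi> d\<close>. Every connection \<open>\<nabla>\<close> satisfies
  \<open>\<nabla>\<^sub>d v = c v - v H\<close> for some complex \<open>c\<close>: by the Leibniz rule the map \<open>v \<mapsto> \<nabla>\<^sub>d v + v H\<close> is
  an endomorphism of the right module of row vectors, and such endomorphisms are scalars
  (\<open>row_module_endomorphism_scalar\<close>, \<open>connection_form\<close>). Since the Lie algebra is spanned by
  \<open>d\<close>, the number \<open>c\<close> determines \<open>\<nabla>\<close>, and the three conditions on \<open>\<nabla>\<close> become conditions
  on \<open>c\<close>.

  \<^item> Because \<open>H\<close> is anti-hermitian, \<open>h(\<nabla>\<^sub>d m, n) + h(m, \<nabla>\<^sub>d n)\<close> differs from \<open>[H, h(m, n)]\<close> by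
    \<open>(c + cnj c) h(m, n)\<close>, so \<open>\<nabla>\<close> is metric exactly if \<open>c\<close> is purely imaginary
    (\<open>scalar_connection_metric_defect\<close>).
  \<^item> The matrix \<open>h(\<nabla>\<^sub>d v\<^sub>0, v\<^sub>0)\<close> is self-adjoint exactly if \<open>\<nabla>\<^sub>d v\<^sub>0 = r v\<^sub>0\<close> with \<open>r\<close> real
    (\<open>self_adjoint_h_metric_real_multiple\<close> is the direction with content); then
    \<open>v\<^sub>0 H = (c - r) v\<^sub>0\<close>.
  \<^item> The torsion vanishes automatically: like the Lie bracket it is alternating and bilinear, and
    the Lie algebra is 1-dimensional.

  Eigenvalues of an anti-hermitian matrix are imaginary
  (\<open>antihermitian_eigenvalue_imaginary\<close>), so \<open>c\<close> and \<open>c - r\<close> are both imaginary, which forces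
  \<open>r = 0\<close>. A Levi-Civita connection therefore makes \<open>v\<^sub>0\<close> an eigenvector with eigenvalue \<open>c\<close>
  (\<open>Levi_Civita_form\<close>). Conversely, an eigenvalue is imaginary, and taking it for \<open>c\<close> gives
  \<open>\<nabla>\<^sub>d v\<^sub>0 = 0\<close> and hence all the conditions (\<open>Levi_Civita_exists\<close>). Both directions rest on the
  existence and uniqueness of the matrix \<open>H\<close>: derivations of the matrix algebra are inner, with a
  unique trace-free generator, and for hermitian derivations this generator is anti-hermitian
  (\<open>D_hat_hermitian_derivation\<close>).
\<close>

section \<open>Matrices acting on row vectors\<close>

lemma mul_Mat [simp]: "mul Mat_alg = (**)"
  and star_Mat [simp]: "star Mat_alg = dagger"
  and smul_Mat: "smul Mat_alg z = map_matrix ((*) z)"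
  and unit_Mat [simp]: "unit Mat_alg = mat 1"
  by (simp_all add: Mat_alg_def)

lemma module_scaleR_Mat: "module_scaleR Mat_alg (v*) r v = complex_of_real r *s (v :: complex^'n)"
  by (simp add: module_scaleR_def smul_Mat vec_eq_iff vector_matrix_mult_def mat_def map_matrix_def
      if_distrib if_distribR cong del: if_weak_cong)

lemma dagger_nth [simp]: "dagger X $ i $ j = cnj (X $ j $ i)"
  by (simp add: dagger_def transpose_def map_matrix_def)

lemma dagger_dagger [simp]: "dagger (dagger X) = X"
  by (simp add: vec_eq_iff)

lemma dagger_mult: "dagger (X ** Y) = dagger Y ** dagger X"
  by (simp add: vec_eq_iff matrix_matrix_mult_def mult.commute)

lemma matrix_mult_diff_left: "X ** (Y - Z) = X ** Y - X ** (Z :: complex^'n^'n)"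
  by (simp add: vec_eq_iff matrix_matrix_mult_def sum_subtractf algebra_simps)

lemma matrix_mult_diff_right: "(X - Y) ** Z = X ** Z - Y ** (Z :: complex^'n^'n)"
  by (simp add: vec_eq_iff matrix_matrix_mult_def sum_subtractf algebra_simps)

text \<open>
  Let \<open>e\<^sub>k\<close> be a standard basis vector and \<open>P v\<close> the matrix with \<open>k\<close>-th row \<open>v\<close> and
  zeros elsewhere. As \<open>e\<^sub>k P v = v\<close>, the single vector \<open>T e\<^sub>k\<close> determines \<open>T v = T e\<^sub>k P v\<close>, and
  \<open>w P v\<close> is the multiple of \<open>v\<close> by the \<open>k\<close>-th entry of \<open>w\<close>.
\<close>

lemma row_module_endomorphism_scalar:
  fixes T :: "complex^'n \<Rightarrow> complex^'n"
  assumes T: "\<And>v a. T (v v* a) = T v v* a"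
  obtains c where "\<And>v. T v = c *s v"
proof -
  fix k :: 'n
  define P :: "complex^'n \<Rightarrow> complex^'n^'n" where "P v = (\<chi> i. if i = k then v else 0)" for v
  have P: "w v* P v = (w $ k) *s v" for v w
    by (simp add: P_def vec_eq_iff vector_matrix_mult_def if_distrib if_distribR
        cong del: if_weak_cong)
  have "T v = (T (axis k 1) $ k) *s v" for v
    using T [of "axis k 1" "P v"] by (simp add: P axis_def)
  then show ?thesis using that by blast
qed

text \<open>
  Right multiplication of row vectors by a central matrix is a module endomorphism.
\<close>

lemma central_matrix_scalar:
  fixes Z :: "complex^'n^'n"
  assumes "\<And>a. Z ** a = a ** Z"
  obtains c where "Z = mat c"
proof -
  obtain c where c: "\<And>v. v v* Z = c *s v"
    using row_module_endomorphism_scalar [of "\<lambda>v. v v* Z"]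
    by (metis vector_matrix_mul_assoc assms)
  have "Z $ i $ j = mat c $ i $ j" for i j
    using arg_cong [OF c [of "axis i 1"], of "\<lambda>v. v $ j"]
    by (simp add: vector_matrix_mult_def axis_def mat_def if_distrib if_distribR
        cong del: if_weak_cong split: if_splits)
  then have "Z = mat c" by (simp add: vec_eq_iff)
  then show ?thesis by (rule that)
qed

section \<open>Derivations of the matrix algebra\<close>

text \<open>
  Identify a column vector \<open>w\<close> with the matrix \<open>C w\<close> whose \<open>k\<close>-th column is \<open>w\<close> and whose other
  columns vanish, so that \<open>a C w = C (a w)\<close>. If \<open>f w\<close> is the \<open>k\<close>-th column of \<open>\<delta> (C w)\<close>, the
  Leibniz rule for \<open>\<delta> (a C w)\<close> reads \<open>f (a w) = \<delta> a w + a f w\<close>, and the matrix of the linear map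
  \<open>f\<close> generates \<open>\<delta>\<close>.
\<close>

lemma derivation_Mat_inner:
  fixes \<delta> :: "complex^'n^'n \<Rightarrow> complex^'n^'n"
  assumes "derivation Mat_alg \<delta>"
  obtains H where "\<And>a. \<delta> a = H ** a - a ** H"
proof -
  have lin: "Vector_Spaces.linear (smul Mat_alg) (smul Mat_alg) \<delta>"
    and Leibniz: "\<And>a b. \<delta> (a ** b) = \<delta> a ** b + a ** \<delta> b"
    using assms by (auto simp: derivation_def)
  fix k :: 'n
  define C :: "complex^'n \<Rightarrow> complex^'n^'n" where "C w = (\<chi> i j. if j = k then w $ i else 0)" for w
  define f where "f w = column k (\<delta> (C w))" for w
  have col_C: "column k (C w) = w" for w
    by (simp add: C_def vec_eq_iff column_def)
  have C_mult: "a ** C w = C (a *v w)" for a w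
    by (simp add: C_def vec_eq_iff matrix_matrix_mult_def matrix_vector_mult_def)
  have col_mult: "column k (a ** M) = a *v column k M" for a M :: "complex^'n^'n"
    by (simp add: vec_eq_iff matrix_matrix_mult_def matrix_vector_mult_def column_def)
  have col_add: "column k (a + M) = column k a + column k M" for a M :: "complex^'n^'n"
    by (simp add: vec_eq_iff column_def)
  have f_linear: "Vector_Spaces.linear (*s) (*s) f"
  proof (rule Vector_Spaces.linear_iff [THEN iffD2], intro conjI allI)
    fix v w show "f (v + w) = f v + f w"
    proof -
      have "C (v + w) = C v + C w" by (simp add: C_def vec_eq_iff)
      then show ?thesis
        using lin by (simp add: f_def Vector_Spaces.linear_iff col_add)
    qed
  next
    fix c v show "f (c *s v) = c *s f v"
    proof -
      have "C (c *s v) = smul Mat_alg c (C v)"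
        by (simp add: C_def vec_eq_iff smul_Mat map_matrix_def)
      then have "\<delta> (C (c *s v)) = smul Mat_alg c (\<delta> (C v))"
        using lin by (simp add: Vector_Spaces.linear_iff)
      then show ?thesis
        by (simp add: f_def vec_eq_iff smul_Mat map_matrix_def column_def)
    qed
  qed (rule vec.vector_space_axioms)+
  define H where "H = matrix f"
  have H: "H *v w = f w" for w
    unfolding H_def by (rule matrix_works [OF f_linear])
  have "\<delta> a *v w = (H ** a - a ** H) *v w" for a w
  proof -
    have "f (a *v w) = \<delta> a *v w + a *v f w"
      by (simp add: f_def C_mult [symmetric] Leibniz col_add col_C col_mult)
    then show ?thesis
      by (simp add: H matrix_vector_mult_diff_rdistrib flip: matrix_vector_mul_assoc)
  qed
  then have "\<delta> a = H ** a - a ** H" for a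
    by (simp add: matrix_eq)
  then show ?thesis using that by blast
qed

text \<open>
  The difference \<open>H - K\<close> commutes with every matrix, so it is scalar, and a trace-free scalar matrix
  is zero.
\<close>

lemma trace_free_generator_unique:
  fixes H K :: "complex^'n^'n"
  assumes "trace H = 0" "trace K = 0" "\<And>a. H ** a - a ** H = K ** a - a ** K"
  shows "H = K"
proof -
  have "(H - K) ** a = a ** (H - K)" for a
    using assms(3) [of a] by (simp add: matrix_mult_diff_left matrix_mult_diff_right algebra_simps)
  then obtain c where c: "H - K = mat c"
    by (rule central_matrix_scalar)
  have "trace (H - K) = 0" by (simp add: assms trace_sub)
  then have "c = 0" by (simp add: c trace_def mat_def)
  then show ?thesis using c by (simp add: vec_eq_iff mat_def)
qed

text \<open>
  Subtracting \<open>trace K / N\<close> from any generator \<open>K\<close> of the derivation makes it trace-free, so the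
  description in \<^const>\<open>D_hat\<close> is met by exactly one matrix \<open>H\<close>. For a hermitian derivation
  \<open>- dagger H\<close> is a trace-free generator as well, so it equals \<open>H\<close>.
\<close>

lemma D_hat_hermitian_derivation:
  fixes D :: "'g \<Rightarrow> complex^'n^'n \<Rightarrow> complex^'n^'n"
  assumes "hermitian_derivation Mat_alg (D x)"
  shows D_hat_commutator: "D x a = D_hat D x ** a - a ** D_hat D x"
    and D_hat_antihermitian: "dagger (D_hat D x) = - D_hat D x"
proof -
  have star: "\<And>a. D x (dagger a) = dagger (D x a)"
    using assms by (simp add: hermitian_derivation_def)
  obtain K where K: "\<And>a. D x a = K ** a - a ** K"
    using assms derivation_Mat_inner unfolding hermitian_derivation_def by blast
  define H where "H = K - mat (trace K / of_nat CARD('n))"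
  have mat_comm: "mat c ** a = a ** mat c" for c and a :: "complex^'n^'n"
    by (simp add: vec_eq_iff matrix_matrix_mult_def mat_def if_distrib if_distribR
        cong del: if_weak_cong)
  have tr: "trace H = 0"
    by (simp add: H_def trace_sub) (simp add: trace_def mat_def)
  have comm: "D x a = H ** a - a ** H" for a
    by (simp add: H_def K matrix_mult_diff_left matrix_mult_diff_right mat_comm)
  have "D_hat D x = H"
    unfolding D_hat_def
    by (rule the_equality) (auto simp: tr comm intro: trace_free_generator_unique)
  moreover have "- dagger H = H"
  proof (rule trace_free_generator_unique)
    have "trace (- dagger H) = - cnj (trace H)"
      by (simp add: trace_def sum_negf)
    then show "trace (- dagger H) = 0"
      by (simp add: tr)
    fix a
    have "D x a = dagger (D x (dagger a))"
      by (simp add: star)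
    also have "\<dots> = dagger (H ** dagger a) - dagger (dagger a ** H)"
      by (simp add: comm vec_eq_iff)
    finally show "- dagger H ** a - a ** - dagger H = H ** a - a ** H"
      by (simp add: comm dagger_mult)
        (simp add: vec_eq_iff matrix_matrix_mult_def sum_negf)
  qed (rule tr)
  ultimately show "D x a = D_hat D x ** a - a ** D_hat D x" "dagger (D_hat D x) = - D_hat D x"
    using comm by (auto simp: neg_eq_iff_add_eq_0 eq_neg_iff_add_eq_0 minus_equation_iff)
qed

section \<open>The metric\<close>

lemma h_metric_mult: "h_metric x u v ** a = h_metric x u (v v* a)"
  by (simp add: vec_eq_iff h_metric_nth matrix_matrix_mult_def vector_matrix_mult_def
      sum_distrib_left algebra_simps)

lemma dagger_h_metric: "dagger (h_metric x u v) = h_metric x v u"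
  by (simp add: vec_eq_iff h_metric_nth)

lemma dagger_mult_h_metric: "dagger a ** h_metric x u v = h_metric x (u v* a) v"
  by (metis dagger_h_metric dagger_mult h_metric_mult)

text \<open>
  With \<open>p = h\<^sub>1(v, v)\<close>, the trace of \<open>p H\<close> is \<open>c |v|\<^sup>2\<close>, and that of \<open>dagger H p\<close> is
  \<open>cnj c |v|\<^sup>2\<close>. Since \<open>dagger H = - H\<close> and the trace is cyclic, they are opposite.
\<close>

lemma antihermitian_eigenvalue_imaginary:
  assumes H: "dagger H = - H" and ev: "left_eigenvector H v c"
  shows "c + cnj c = 0"
proof -
  let ?p = "h_metric 1 v v"
  have v: "v \<noteq> 0" "v v* H = c *s v"
    using ev by (auto simp: left_eigenvector_def)
  have right: "trace (?p ** H) = c * trace ?p"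
    by (simp add: h_metric_mult v) (simp add: trace_def h_metric_nth sum_distrib_left algebra_simps)
  have "trace (dagger H ** ?p) = cnj c * trace ?p"
    by (simp add: dagger_mult_h_metric v)
      (simp add: trace_def h_metric_nth sum_distrib_left algebra_simps)
  moreover have "trace (dagger H ** ?p) = - trace (?p ** H)"
    by (subst trace_mul_sym)
      (simp add: H trace_def matrix_matrix_mult_def sum_negf)
  moreover have "trace ?p \<noteq> 0"
  proof -
    have "trace ?p = complex_of_real (\<Sum>i\<in>UNIV. (cmod (v $ i))\<^sup>2)"
      by (simp add: trace_def h_metric_nth complex_norm_square mult.commute flip: of_real_power)
    moreover have "(\<Sum>i\<in>UNIV. (cmod (v $ i))\<^sup>2) \<noteq> 0"
      using v(1) by (subst sum_nonneg_eq_0_iff) (auto simp: vec_eq_iff)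
    ultimately show ?thesis by (metis of_real_eq_0_iff)
  qed
  ultimately show ?thesis
    using right by (metis add.commute add_eq_0_iff distrib_right mult_eq_0_iff)
qed

text \<open>
  Self-adjointness says that the rank-one matrices \<open>dagger w v\<close> and \<open>dagger v w\<close> agree. A row in
  which the entry of \<open>v\<close> does not vanish shows that \<open>w\<close> is a multiple of \<open>v\<close>, and the diagonal
  entry of that row shows that the factor is real.
\<close>

lemma self_adjoint_h_metric_real_multiple:
  assumes "x \<noteq> 0" and v: "v \<noteq> 0" and sa: "self_adjoint Mat_alg (h_metric x w v)"
  obtains r where "w = complex_of_real r *s v"
proof -
  have eq: "cnj (v $ i) * w $ j = cnj (w $ i) * v $ j" for i j
    using arg_cong [OF sa [unfolded self_adjoint_def star_Mat dagger_h_metric], of "\<lambda>M. M $ i $ j"]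
      \<open>x \<noteq> 0\<close>
    by (simp add: h_metric_nth)
  obtain i where i: "v $ i \<noteq> 0"
    using v by (auto simp: vec_eq_iff)
  define z where "z = cnj (w $ i / v $ i)"
  have w: "w = z *s v"
    using eq [of i] i by (simp add: z_def vec_eq_iff field_simps)
  have "z = cnj z"
    using eq [of i i] i by (simp add: z_def field_simps)
  then have "z = complex_of_real (Re z)"
    by (metis Reals_cnj_iff of_real_Re)
  with w show ?thesis using that by metis
qed

section \<open>Levi-Civita connections\<close>

text \<open>
  Otherwise the image of \<open>\<phi>\<close> would be zero and could not generate the module of row vectors.
\<close>

lemma \<phi>_nonzero:
  assumes rc: "real_calculus Mat_alg br D ((v*) :: complex^'n \<Rightarrow> _) \<phi>" and sp: "span {d} = UNIV"
  shows "\<phi> d \<noteq> 0"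
proof
  interpret real_calculus Mat_alg br D "(v*)" \<phi> by (rule rc)
  assume 0: "\<phi> d = 0"
  have "\<phi> y = 0" for y
  proof -
    have "y \<in> span {d}" using sp by simp
    then obtain r where "y = r *\<^sub>R d" by (auto simp: span_singleton)
    then show ?thesis by (simp add: \<phi>_scaleR 0 module_scaleR_Mat)
  qed
  then have "right_submodule (v*) hull range \<phi> \<subseteq> {0}"
    by (intro hull_minimal) (auto simp: right_submodule_def)
  then have "axis undefined 1 = (0 :: complex^'n)"
    using \<phi>_generates by blast
  then show False by simp
qed

text \<open>
  The map \<open>v \<mapsto> v H\<close> satisfies the Leibniz rule with the opposite sign, so adding it to \<open>\<nabla>\<^sub>d\<close> cancels
  the derivative terms and leaves an endomorphism of the right module.
\<close>

lemma connection_form: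
  assumes "affine_connection Mat_alg br D ((v*) :: complex^'n \<Rightarrow> _) \<phi> nabla"
  obtains c where "\<And>v. nabla d v = c *s v - v v* D_hat D d"
proof -
  interpret affine_connection Mat_alg br D "(v*)" \<phi> nabla by (rule assms)
  obtain c where "\<And>v. nabla d v + v v* D_hat D d = c *s v"
  proof (rule row_module_endomorphism_scalar [of "\<lambda>v. nabla d v + v v* D_hat D d"])
    fix v a
    have "nabla d (v v* a) = nabla d v v* a + v v* D d a"
      by (rule nabla_Leibniz)
    then show "nabla d (v v* a) + (v v* a) v* D_hat D d = (nabla d v + v v* D_hat D d) v* a"
      by (simp add: D_hat_commutator [of D d, OF D_hermitian] vector_matrix_mult_diff_rdistrib
          vector_matrix_mul_assoc vector_matrix_left_distrib add.assoc)
  qed blast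
  then have "nabla d v = c *s v - v v* D_hat D d" for v
    by (metis add_diff_cancel_right')
  then show ?thesis using that by blast
qed

text \<open>
  The commutator with \<open>H\<close> is the derivative \<open>\<partial>(h(m, n))\<close>, so the last summand measures how far
  the connection \<open>v \<mapsto> c v - v H\<close> is from being metric.
\<close>

lemma scalar_connection_metric_defect:
  assumes H: "dagger H = - H"
  shows "h_metric x (c *s m - m v* H) n + h_metric x m (c *s n - n v* H)
    = (H ** h_metric x m n - h_metric x m n ** H) + h_metric x m ((c + cnj c) *s n)"
proof -
  have "H ** h_metric x m n = - h_metric x (m v* H) n"
    unfolding dagger_mult_h_metric [symmetric] H
    by (simp add: vec_eq_iff matrix_matrix_mult_def sum_negf)
  then show ?thesis
    by (simp add: h_metric_mult) (simp add: vec_eq_iff h_metric_nth algebra_simps)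
qed

text \<open>
  Metricity makes the number \<open>c\<close> of the connection imaginary, and the self-adjointness condition
  gives \<open>\<nabla>\<^sub>d v\<^sub>0 = r v\<^sub>0\<close> with \<open>r\<close> real, hence an eigenvalue \<open>c - r\<close>. This eigenvalue is imaginary as
  well, so \<open>r\<close> vanishes.
\<close>

lemma Levi_Civita_form:
  assumes "pseudo_Riemannian_calculus Mat_alg br D ((v*) :: complex^'n \<Rightarrow> _) \<phi> (h_metric x) nabla"
    and "x \<noteq> 0" and "\<phi> d \<noteq> 0"
  obtains c where "left_eigenvector (D_hat D d) (\<phi> d) c"
    and "\<And>v. nabla d v = c *s v - v v* D_hat D d"
proof -
  interpret pseudo_Riemannian_calculus Mat_alg br D "(v*)" \<phi> "h_metric x" nabla by (rule assms)
  let ?H = "D_hat D d" and ?v = "\<phi> d"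
  note H = D_hat_antihermitian [of D d, OF D_hermitian]
  obtain c where nabla: "\<And>v. nabla d v = c *s v - v v* ?H"
    using connection_form affine_connection_axioms by blast
  have "h_metric x ?v ((c + cnj c) *s ?v) = 0"
    using nabla_metric [of d ?v ?v] scalar_connection_metric_defect [OF H, of x c ?v ?v]
    by (simp add: nabla D_hat_commutator [of D d, OF D_hermitian])
  then have c: "c + cnj c = 0"
    using \<open>\<phi> d \<noteq> 0\<close> \<open>x \<noteq> 0\<close> by (auto simp: vec_eq_iff h_metric_nth simp flip: distrib_right)
  obtain r where r: "nabla d ?v = complex_of_real r *s ?v"
    using self_adjoint_h_metric_real_multiple [OF \<open>x \<noteq> 0\<close> \<open>\<phi> d \<noteq> 0\<close> h_nabla_self_adjoint] by blast
  have "?v v* ?H = c *s ?v - nabla d ?v"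
    by (simp add: nabla)
  also have "\<dots> = (c - of_real r) *s ?v"
    by (simp add: r vec_eq_iff algebra_simps)
  finally have ev: "left_eigenvector ?H ?v (c - of_real r)"
    using \<open>\<phi> d \<noteq> 0\<close> by (simp add: left_eigenvector_def)
  have "(c - of_real r) + cnj (c - of_real r) = 0"
    by (rule antihermitian_eigenvalue_imaginary [OF H ev])
  with c have "r = 0"
    by (simp add: complex_eq_iff)
  with ev nabla show ?thesis using that by simp
qed

text \<open>
  Let \<open>\<rho> y\<close> be the coordinate of \<open>y\<close> with respect to the basis \<open>d\<close>, and extend
  \<open>L v = c v - v H\<close> linearly in \<open>y\<close>. The eigenvalue equation says that \<open>L\<close> kills the image of
  \<open>\<phi>\<close>, so that self-adjointness is trivial and the torsion reduces to \<open>\<phi>\<close> of the Lie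
  bracket, which is zero. The connection is metric because the eigenvalue is imaginary.
\<close>

lemma Levi_Civita_exists:
  assumes "real_metric_calculus Mat_alg br D ((v*) :: complex^'n \<Rightarrow> _) \<phi> (h_metric x)"
    and d: "d \<noteq> 0" and sp: "span {d} = UNIV"
    and ev: "left_eigenvector (D_hat D d) (\<phi> d) c"
  shows "\<exists>nabla. pseudo_Riemannian_calculus Mat_alg br D (v*) \<phi> (h_metric x) nabla"
proof -
  interpret real_metric_calculus Mat_alg br D "(v*)" \<phi> "h_metric x" by (rule assms)
  define \<rho> where "\<rho> y = representation {d} y d" for y
  have ind: "independent {d}" using d by simp
  have \<rho>_add: "\<rho> (y + z) = \<rho> y + \<rho> z" for y z
    using representation_add [OF ind, of z y] sp by (simp add: \<rho>_def)
  have \<rho>_scale: "\<rho> (r *\<^sub>R y) = r * \<rho> y" for r y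
    using representation_scale [OF ind, of y r] sp by (simp add: \<rho>_def)
  have \<rho>: "y = \<rho> y *\<^sub>R d" for y
    using sum_representation_eq [OF ind, of y "{d}"] sp by (simp add: \<rho>_def)
  let ?H = "D_hat D d"
  note H = D_hat_antihermitian [of D d, OF D_hermitian]
  have c: "c + cnj c = 0"
    by (rule antihermitian_eigenvalue_imaginary [OF H ev])
  define L where "L v = c *s v - v v* ?H" for v
  define nabla where "nabla y v = complex_of_real (\<rho> y) *s L v" for y v
  have D: "D y a = smul Mat_alg (complex_of_real (\<rho> y)) (?H ** a - a ** ?H)" for y a
    by (subst \<rho>) (simp only: D_scaleR D_hat_commutator [of D d, OF D_hermitian])
  have L_add: "L (v + w) = L v + L w" for v w
    by (simp add: L_def vector_matrix_left_distrib vec.scale_right_distrib)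
  have L_scale: "L (z *s v) = z *s L v" for z v
    by (simp add: L_def scalar_vector_matrix_assoc vec_eq_iff algebra_simps)
  have L_Leibniz: "L (v v* a) = L v v* a + v v* (?H ** a - a ** ?H)" for v a
    by (simp add: L_def vector_matrix_mul_assoc vector_matrix_mult_diff_rdistrib
        vector_matrix_mult_diff_distrib scalar_vector_matrix_assoc)
  have L_\<phi>: "L (\<phi> y) = 0" for y
  proof -
    have "L (\<phi> d) = 0" using ev by (simp add: L_def left_eigenvector_def)
    moreover have "\<phi> y = complex_of_real (\<rho> y) *s \<phi> d"
      by (subst \<rho>) (simp only: \<phi>_scaleR module_scaleR_Mat)
    ultimately show ?thesis
      by (simp add: L_scale)
  qed
  have br0: "br y z = 0" for y z
  proof -
    have "br y z = br (\<rho> y *\<^sub>R d) (\<rho> z *\<^sub>R d)" using \<rho> by metis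
    then show ?thesis
      by (simp add: bilinear_lmul [OF br_bilinear] bilinear_rmul [OF br_bilinear] br_self)
  qed
  have \<phi>0: "\<phi> 0 = 0" using \<phi>_add [of 0 0] by simp
  have "pseudo_Riemannian_calculus Mat_alg br D (v*) \<phi> (h_metric x) nabla"
  proof unfold_locales
    fix y z :: 'a and m n :: "complex^'n" and a :: "complex^'n^'n" and r :: real
    show "nabla y (m + n) = nabla y m + nabla y n"
      by (simp add: nabla_def L_add vec.scale_right_distrib)
    show "nabla (y + z) m = nabla y m + nabla z m"
      by (simp add: nabla_def \<rho>_add vec.scale_left_distrib)
    show "nabla (r *\<^sub>R y) m = module_scaleR Mat_alg (v*) r (nabla y m)"
      by (simp add: nabla_def \<rho>_scale module_scaleR_Mat)
    have "v v* smul Mat_alg s b = s *s (v v* b)" for v s and b :: "complex^'n^'n"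
      by (simp add: vec_eq_iff vector_matrix_mult_def smul_Mat map_matrix_def sum_distrib_left
          algebra_simps)
    then show "nabla y (m v* a) = nabla y m v* a + m v* D y a"
      by (simp add: nabla_def D L_Leibniz scalar_vector_matrix_assoc vec.scale_right_distrib)
    show "self_adjoint Mat_alg (h_metric x (nabla y (\<phi> z)) (\<phi> w))" for w
      by (simp add: nabla_def L_\<phi> self_adjoint_def vec_eq_iff h_metric_nth)
    have "h_metric x (L m) n + h_metric x m (L n) = ?H ** h_metric x m n - h_metric x m n ** ?H"
      using scalar_connection_metric_defect [OF H, of x c m n] c
      by (simp add: L_def) (simp add: vec_eq_iff h_metric_nth)
    then show "D y (h_metric x m n) = h_metric x (nabla y m) n + h_metric x m (nabla y n)"
      by (simp add: D flip: \<open>_ = ?H ** _ - _\<close>)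
        (simp add: nabla_def smul_Mat map_matrix_def vec_eq_iff h_metric_nth algebra_simps)
    show "nabla y (\<phi> z) - nabla z (\<phi> y) - \<phi> (br y z) = 0"
      by (simp add: nabla_def L_\<phi> br0 \<phi>0)
  qed
  then show ?thesis by blast
qed

theorem proposition4p11:
  fixes br :: "'g::real_vector \<Rightarrow> 'g \<Rightarrow> 'g"
    and d :: 'g
    and D :: "'g \<Rightarrow> complex^'n^'n \<Rightarrow> complex^'n^'n"
    and \<phi> :: "'g \<Rightarrow> complex^'n"
    and x :: real
  assumes "dim (UNIV :: 'g set) = 1"
    and "span {d} = UNIV"
    and "real_calculus Mat_alg br D (v*) \<phi>"
    and "x \<noteq> 0"
    and "real_metric_calculus Mat_alg br D (v*) \<phi> (h_metric x)"
  shows "((\<exists>!nabla. pseudo_Riemannian_calculus Mat_alg br D (v*) \<phi> (h_metric x) nabla)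
            \<longleftrightarrow> (\<exists>c. left_eigenvector (D_hat D d) (\<phi> d) c)) \<and>
         (\<forall>c nabla. left_eigenvector (D_hat D d) (\<phi> d) c \<longrightarrow>
            pseudo_Riemannian_calculus Mat_alg br D (v*) \<phi> (h_metric x) nabla \<longrightarrow>
            (\<forall>v. nabla d v = c *s v - v v* D_hat D d))"
proof -
  let ?LC = "pseudo_Riemannian_calculus Mat_alg br D (v*) \<phi> (h_metric x)"
  let ?ev = "left_eigenvector (D_hat D d) (\<phi> d)"
  have v: "\<phi> d \<noteq> 0"
    using \<phi>_nonzero assms by blast
  have d: "d \<noteq> 0"
  proof
    assume "d = 0"
    then have "dim (UNIV :: 'g set) = card ({} :: 'g set)"
      using dim_span_eq_card_independent [OF independent_empty, where 'a = 'g] assms(2) by simp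
    with assms(1) show False by simp
  qed
  have form: "nabla d v = c *s v - v v* D_hat D d" if ev: "?ev c" and LC: "?LC nabla" for c nabla v
  proof -
    obtain c' where "?ev c'" and c': "nabla d v = c' *s v - v v* D_hat D d"
      using Levi_Civita_form [OF LC \<open>x \<noteq> 0\<close> v] by metis
    then have "c *s \<phi> d = c' *s \<phi> d"
      using ev by (simp add: left_eigenvector_def)
    then show ?thesis using v c' by simp
  qed
  have unique: "nabla = nabla'" if "?ev c" "?LC nabla" "?LC nabla'" for c nabla nabla'
  proof (intro ext)
    fix y v
    interpret N: pseudo_Riemannian_calculus Mat_alg br D "(v*)" \<phi> "h_metric x" nabla by (rule that)
    interpret N': pseudo_Riemannian_calculus Mat_alg br D "(v*)" \<phi> "h_metric x" nabla' by (rule that)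
    have "y \<in> span {d}" using assms(2) by simp
    then obtain r where "y = r *\<^sub>R d" by (auto simp: span_singleton)
    then show "nabla y v = nabla' y v"
      using form [OF that(1,2)] form [OF that(1,3)] by (simp add: N.nabla_scaleR N'.nabla_scaleR)
  qed
  have "\<exists>c. ?ev c" if "?LC nabla" for nabla
    using Levi_Civita_form [OF that \<open>x \<noteq> 0\<close> v] by metis
  moreover have "\<exists>nabla. ?LC nabla" if "?ev c" for c
    using Levi_Civita_exists [OF assms(5) d assms(2) that] .
  ultimately have "(\<exists>!nabla. ?LC nabla) \<longleftrightarrow> (\<exists>c. ?ev c)"
    using unique by (metis (no_types, lifting))
  then show ?thesis using form by blast
qed

end
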